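(* Let $\Lambda\subseteq\mathbb{Z}^n$ be a $k$-dimensional lattice with basis matrix $B$ (a $k\times n$ integer matrix). For indices $1\le i_1<\dots<i_k\le n$, let $B_{i_1,\dots,i_k}$ be the $k\times k$ submatrix of $B$ formed by columns $i_1,\dots,i_k$. Let $S=\mathrm{diag}(S_1,\dots,S_n)$ with nonzero real numbers $S_1,\dots,S_n$. Then $$\det\Lambda^\perp_S=\frac{|S_1\cdots S_n|}{\Omega}\cdot\sqrt{\sum_{1\le i_1<\dots<i_k\le n}\left(\frac{\det B_{i_1,\dots,i_k}}{S_{i_1}\cdots S_{i_k}}\right)^2},$$ where $\Omega$ is the greatest common divisor of all $k\times k$ minors of $B$.
   Context: For a lattice $\Lambda\subseteq\mathbb{Z}^n$, $E_\Lambda$ is the $\mathbb{Q}$-subspace of $\mathbb{Q}^n$ spanned by a basis of $\Lambda$ and the orthogonal lattice is $\Lambda^\perp=\mathbb{Z}^n\cap E_\Lambda^\perp$ (orthogonal complement for the standard inner product). For a lattice $\Gamma\subseteq\mathbb{R}^n$ (row vectors) and $T\in\mathrm{GL}_n(\mathbb{R})$, $\Gamma_T=\{\vec{x}T:\vec{x}\in\Gamma\}$; $\Lambda^\perp_S=(\Lambda^\perp)_S$. The determinant of a lattice with basis matrix $C$ is $\sqrt{\det(CC^t)}$ (the zero lattice has determinant $1$). *)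

theory Defs
  imports
    Complex_Main
    "Jordan_Normal_Form.VS_Connect"
    "Jordan_Normal_Form.DL_Rank"
    "Jordan_Normal_Form.DL_Submatrix"
begin

section \<open>Lattices and their basis matrices\<close>

text \<open>
  Basis vectors are the rows of the matrix, so the integer combinations \<open>x C\<close> of the rows
  appear as \<open>C\<^sup>T *\<^sub>v x\<close>. A matrix with no rows is a basis matrix of the zero lattice.
\<close>

definition is_basis_matrix :: "nat \<Rightarrow> real mat \<Rightarrow> real vec set \<Rightarrow> bool" where
  "is_basis_matrix n C \<Gamma> \<longleftrightarrow>
     dim_col C = n \<and>
     distinct (rows C) \<and>
     module.lin_indpt class_ring (module_vec TYPE(real) n) (set (rows C)) \<and>
     \<Gamma> = {C\<^sup>T *\<^sub>v map_vec real_of_int x | x. x \<in> carrier_vec (dim_row C)}"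

definition is_int_basis_matrix :: "nat \<Rightarrow> int mat \<Rightarrow> int vec set \<Rightarrow> bool" where
  "is_int_basis_matrix n B \<Lambda> \<longleftrightarrow>
     is_basis_matrix n (map_mat real_of_int B) (map_vec real_of_int ` \<Lambda>)"

text \<open>
  The values of the next two constants do not depend on the chosen basis matrix: see
  \<open>lattice_det_eq\<close> and \<open>rat_space_eq\<close> below.
\<close>

definition lattice_det :: "nat \<Rightarrow> real vec set \<Rightarrow> real" where
  "lattice_det n \<Gamma> = (let C = (SOME C. is_basis_matrix n C \<Gamma>) in sqrt (det (C * C\<^sup>T)))"

definition rat_space :: "nat \<Rightarrow> int vec set \<Rightarrow> rat vec set" where
  "rat_space n \<Lambda> =
     vec_space.row_space n (map_mat rat_of_int (SOME B. is_int_basis_matrix n B \<Lambda>))"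

definition orth_lattice :: "nat \<Rightarrow> int vec set \<Rightarrow> int vec set" where
  "orth_lattice n \<Lambda> =
     {x \<in> carrier_vec n.
        map_vec rat_of_int x \<in> vec_module.orthogonal_complement n (rat_space n \<Lambda>)}"

text \<open>The image of \<open>\<Gamma>\<close> under \<open>x \<mapsto> x T\<close> for row vectors \<open>x\<close>.\<close>

definition lattice_transform :: "real vec set \<Rightarrow> real mat \<Rightarrow> real vec set" where
  "lattice_transform \<Gamma> T = (\<lambda>x. T\<^sup>T *\<^sub>v x) ` \<Gamma>"

section \<open>Independence of the chosen basis matrix\<close>

lemma is_basis_matrix_kernel:
  assumes C: "is_basis_matrix n C \<Gamma>"
    and x: "x \<in> carrier_vec (dim_row C)" and 0: "C\<^sup>T *\<^sub>v x = 0\<^sub>v n"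
  shows "x = 0\<^sub>v (dim_row C)"
proof (rule ccontr)
  assume "x \<noteq> 0\<^sub>v (dim_row C)"
  moreover have "C\<^sup>T \<in> carrier_mat n (dim_row C)" "distinct (cols C\<^sup>T)"
    using C by (auto simp: is_basis_matrix_def)
  ultimately have "module.lin_dep class_ring (module_vec TYPE(real) n) (set (cols C\<^sup>T))"
    using vec_space.lin_depI x 0 by blast
  then show False using C by (simp add: is_basis_matrix_def)
qed

lemma is_basis_matrix_change:
  assumes C: "is_basis_matrix n C \<Gamma>" and D: "is_basis_matrix n D \<Gamma>"
    and Cc: "C \<in> carrier_mat k n" and Dc: "D \<in> carrier_mat l n"
  obtains U where "U \<in> carrier_mat k l" "C = map_mat real_of_int U * D"
proof -
  have Cd: "dim_row C = k" "dim_col C = n" and Dd: "dim_row D = l" "dim_col D = n"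
    using Cc Dc by auto
  have "\<exists>x \<in> carrier_vec l. row C i = D\<^sup>T *\<^sub>v map_vec real_of_int x"
    if i: "i < k" for i
  proof -
    have "map_vec real_of_int (unit_vec k i) = unit_vec k i"
      by (intro eq_vecI) (auto simp: unit_vec_def)
    moreover have "C\<^sup>T *\<^sub>v unit_vec k i = row C i"
      using i Cd by (intro eq_vecI) auto
    ultimately have "row C i \<in> \<Gamma>"
      using C unfolding is_basis_matrix_def
      by (metis (mono_tags, lifting) Cd(1) mem_Collect_eq unit_vec_carrier)
    then show ?thesis using D Dd unfolding is_basis_matrix_def by blast
  qed
  then obtain f where f: "\<And>i. i < k \<Longrightarrow> f i \<in> carrier_vec l"
      "\<And>i. i < k \<Longrightarrow> row C i = D\<^sup>T *\<^sub>v map_vec real_of_int (f i)"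
    by metis
  define U where "U = mat k l (\<lambda>(i, j). f i $ j)"
  have U: "U \<in> carrier_mat k l" by (simp add: U_def)
  have "C = map_mat real_of_int U * D"
  proof (rule eq_matI)
    fix i j assume "i < dim_row (map_mat real_of_int U * D)" "j < dim_col (map_mat real_of_int U * D)"
    then have ij: "i < k" "j < n" "j < dim_col D" "j < dim_col C"
      using U Dd Cd by auto
    have "row (map_mat real_of_int U) i = map_vec real_of_int (f i)"
      using f(1)[OF ij(1)] ij by (intro eq_vecI) (auto simp: U_def)
    moreover have "C $$ (i, j) = row C i $ j" using ij Cd by simp
    moreover have "\<dots> = col D j \<bullet> map_vec real_of_int (f i)"
      using f(2)[OF ij(1)] ij by simp
    moreover have "\<dots> = map_vec real_of_int (f i) \<bullet> col D j"
      using f(1)[OF ij(1)] Dd by (intro comm_scalar_prod[of _ l]) auto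
    ultimately show "C $$ (i, j) = (map_mat real_of_int U * D) $$ (i, j)"
      using ij U by simp
  qed (use U Cd Dd in auto)
  with U show thesis using that by blast
qed

lemma is_basis_matrix_left_cancel:
  assumes C: "is_basis_matrix n C \<Gamma>"
    and Cc: "C \<in> carrier_mat k n"
    and M: "M \<in> carrier_mat k k" and eq: "C = M * C"
  shows "M = 1\<^sub>m k"
proof -
  have Cd: "dim_row C = k" "dim_col C = n" using Cc by auto
  have *: "row M i = unit_vec k i" if i: "i < k" for i
  proof -
    let ?x = "row M i - unit_vec k i"
    have r: "row M i \<in> carrier_vec k" using M i by auto
    have "C\<^sup>T *\<^sub>v row M i = row C i"
    proof (rule eq_vecI)
      fix j assume "j < dim_vec (row C i)"
      then have j: "j < n" "j < dim_col C" using Cd by auto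
      have "(C\<^sup>T *\<^sub>v row M i) $ j = col C j \<bullet> row M i" using j Cd by simp
      also have "\<dots> = row M i \<bullet> col C j" using r j Cd by (intro comm_scalar_prod[of _ k]) auto
      also have "\<dots> = (M * C) $$ (i, j)" using i j M Cd by simp
      also have "\<dots> = row C i $ j" using i j Cd by (simp add: eq[symmetric])
      finally show "(C\<^sup>T *\<^sub>v row M i) $ j = row C i $ j" .
    qed (use Cd in auto)
    moreover have "C\<^sup>T *\<^sub>v unit_vec k i = row C i"
      using i Cd by (intro eq_vecI) auto
    moreover have "C\<^sup>T *\<^sub>v ?x = C\<^sup>T *\<^sub>v row M i - C\<^sup>T *\<^sub>v unit_vec k i"
      using Cc r by (intro mult_minus_distrib_mat_vec[of _ n k]) auto
    ultimately have "C\<^sup>T *\<^sub>v ?x = row C i - row C i" by (simp only:)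
    also have "\<dots> = 0\<^sub>v n" using Cc i by (intro minus_cancel_vec) auto
    finally have x0: "?x = 0\<^sub>v k"
      using is_basis_matrix_kernel[OF C, of ?x] r Cd by simp
    show ?thesis
    proof (rule eq_vecI)
      fix j assume "j < dim_vec (unit_vec k i :: real vec)"
      then have j: "j < k" by simp
      have "?x $ j = 0" using x0 j by simp
      then show "row M i $ j = unit_vec k i $ j" using j r by simp
    qed (use M in simp)
  qed
  show ?thesis
  proof (rule eq_rowI)
    fix i assume "i < dim_row (1\<^sub>m k :: real mat)"
    then show "row M i = row (1\<^sub>m k) i" using * by simp
  qed (use M in auto)
qed

lemma is_basis_matrix_unimodular:
  assumes C: "is_basis_matrix n C \<Gamma>" and D: "is_basis_matrix n D \<Gamma>"
    and Cc: "C \<in> carrier_mat k n" and Dc: "D \<in> carrier_mat l n"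
  obtains U V where
    "k = l" "U \<in> carrier_mat l l" "V \<in> carrier_mat l l"
    "C = map_mat real_of_int U * D" "U * V = 1\<^sub>m l"
proof -
  let ?R = "map_mat real_of_int"
  obtain U where U: "U \<in> carrier_mat k l" "C = ?R U * D"
    using is_basis_matrix_change[OF C D Cc Dc] .
  obtain V where V: "V \<in> carrier_mat l k" "D = ?R V * C"
    using is_basis_matrix_change[OF D C Dc Cc] .
  have RU: "?R U \<in> carrier_mat k l" and RV: "?R V \<in> carrier_mat l k" using U V by auto
  have "C = (?R U * ?R V) * C"
    using assoc_mult_mat[OF RU RV Cc] U(2) V(2) by argo
  then have UV: "?R U * ?R V = 1\<^sub>m k"
    using is_basis_matrix_left_cancel[OF C Cc] RU RV by (meson mult_carrier_mat)
  have "D = (?R V * ?R U) * D"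
    using assoc_mult_mat[OF RV RU Dc] U(2) V(2) by argo
  then have VU: "?R V * ?R U = 1\<^sub>m l"
    using is_basis_matrix_left_cancel[OF D Dc] RU RV by (meson mult_carrier_mat)
  have "real k = (\<Sum>i<k. (?R U * ?R V) $$ (i, i))" by (simp add: UV)
  also have "\<dots> = (\<Sum>i<k. \<Sum>j<l. ?R U $$ (i, j) * ?R V $$ (j, i))"
    using RU RV by (intro sum.cong) (auto simp: scalar_prod_def atLeast0LessThan)
  also have "\<dots> = (\<Sum>j<l. \<Sum>i<k. ?R V $$ (j, i) * ?R U $$ (i, j))"
    by (subst sum.swap) (simp add: mult.commute)
  also have "\<dots> = (\<Sum>j<l. (?R V * ?R U) $$ (j, j))"
    using RU RV by (intro sum.cong) (auto simp: scalar_prod_def atLeast0LessThan)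
  also have "\<dots> = real l" by (simp add: VU)
  finally have kl: "k = l" by simp
  have "?R (U * V) = ?R (1\<^sub>m k)"
    by (simp only: of_int_hom.mat_hom_mult[OF U(1) V(1)] UV of_int_hom.mat_hom_one)
  then have "U * V = 1\<^sub>m k" by (rule of_int_hom.mat_hom_inj)
  then show thesis using that[OF kl, of U V] U V(1) unfolding kl by blast
qed

lemma lattice_det_eq:
  assumes C: "is_basis_matrix n C \<Gamma>"
  shows "lattice_det n \<Gamma> = sqrt (det (C * C\<^sup>T))"
proof -
  define D where "D = (SOME C. is_basis_matrix n C \<Gamma>)"
  have D: "is_basis_matrix n D \<Gamma>" unfolding D_def using C by (rule someI)
  define k l where "k = dim_row C" and "l = dim_row D"
  have Cc: "C \<in> carrier_mat k n" and Dc: "D \<in> carrier_mat l n"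
    using C D by (auto simp: is_basis_matrix_def k_def l_def)
  let ?R = "map_mat real_of_int"
  obtain U V where UV: "k = l" "U \<in> carrier_mat l l" "V \<in> carrier_mat l l"
    "C = ?R U * D" "U * V = 1\<^sub>m l"
    using is_basis_matrix_unimodular[OF C D Cc Dc] .
  have RU: "?R U \<in> carrier_mat l l" using UV by auto
  have "det U * det V = 1" using det_mult[OF UV(2,3)] UV(5) by simp
  then have "det U * det U = 1"
    using zmult_eq_1_iff by auto
  then have one: "det (?R U) * det (?R U) = 1"
    by (metis of_int_1 of_int_hom.hom_det of_int_mult)
  have "C * C\<^sup>T = (?R U * D) * (D\<^sup>T * (?R U)\<^sup>T)"
    using UV(4) transpose_mult[OF RU Dc] by simp
  also have "\<dots> = ?R U * (D * D\<^sup>T) * (?R U)\<^sup>T"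
  proof -
    have Dt: "D\<^sup>T \<in> carrier_mat n l" and Ut: "(?R U)\<^sup>T \<in> carrier_mat l l" using Dc RU by auto
    show ?thesis
      using assoc_mult_mat[OF mult_carrier_mat[OF RU Dc] Dt Ut] assoc_mult_mat[OF RU Dc Dt] by simp
  qed
  finally have "det (C * C\<^sup>T) = det (?R U) * det (D * D\<^sup>T) * det (?R U)\<^sup>T"
    using RU Dc by (simp add: det_mult[of _ l])
  also have "\<dots> = (det (?R U) * det (?R U)) * det (D * D\<^sup>T)"
    using det_transpose[OF RU] by (simp only: mult_ac)
  also have "\<dots> = det (D * D\<^sup>T)" by (simp only: one mult_1)
  finally show ?thesis by (simp add: lattice_det_def Let_def D_def)
qed

lemma row_space_mult_subset:
  fixes A :: "'a :: field mat"
  assumes P: "P \<in> carrier_mat m l" and A: "A \<in> carrier_mat l n"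
  shows "vec_space.row_space n (P * A) \<subseteq> vec_space.row_space n A"
proof
  fix w assume w: "w \<in> vec_space.row_space n (P * A)"
  have PA: "P * A \<in> carrier_mat m n" using P A by simp
  from w obtain y where y: "y \<in> carrier_vec m" "(P * A)\<^sup>T *\<^sub>v y = w" "w \<in> carrier_vec n"
    using vec_space.row_space_eq[OF PA] P A by auto
  have "w = A\<^sup>T *\<^sub>v (P\<^sup>T *\<^sub>v y)"
    using y transpose_mult[OF P A] assoc_mult_mat_vec[of "A\<^sup>T" n l "P\<^sup>T" m y] P A by simp
  moreover have "P\<^sup>T *\<^sub>v y \<in> carrier_vec l"
    using P y(1) by (intro mult_mat_vec_carrier[of _ l m]) auto
  ultimately show "w \<in> vec_space.row_space n A"
    using vec_space.row_space_eq[OF A] y(3) A by auto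
qed

lemma rat_space_eq:
  assumes B: "is_int_basis_matrix n B \<Lambda>"
  shows "rat_space n \<Lambda> = vec_space.row_space n (map_mat rat_of_int B)"
proof -
  have sub: "vec_space.row_space n (map_mat rat_of_int B1) \<subseteq> vec_space.row_space n (map_mat rat_of_int B2)"
    if B12: "is_int_basis_matrix n B1 \<Lambda>" "is_int_basis_matrix n B2 \<Lambda>" for B1 B2
  proof -
    define k l where "k = dim_row B1" and "l = dim_row B2"
    have B1: "B1 \<in> carrier_mat k n" and B2: "B2 \<in> carrier_mat l n"
      using B12 by (auto simp: is_int_basis_matrix_def is_basis_matrix_def k_def l_def)
    have "map_mat real_of_int B1 \<in> carrier_mat k n" "map_mat real_of_int B2 \<in> carrier_mat l n"
      using B1 B2 by auto
    then obtain U where U: "U \<in> carrier_mat k l"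
      "map_mat real_of_int B1 = map_mat real_of_int U * map_mat real_of_int B2"
      using is_basis_matrix_change[OF B12[unfolded is_int_basis_matrix_def]] by blast
    have "map_mat real_of_int B1 = map_mat real_of_int (U * B2)"
      using U(2) of_int_hom.mat_hom_mult[OF U(1) B2] by metis
    then have "B1 = U * B2" by (rule of_int_hom.mat_hom_inj)
    then have "map_mat rat_of_int B1 = map_mat rat_of_int U * map_mat rat_of_int B2"
      using of_int_hom.mat_hom_mult[OF U(1) B2] by metis
    then show ?thesis
      using row_space_mult_subset[of "map_mat rat_of_int U" k l "map_mat rat_of_int B2" n] U(1) B2
      by simp
  qed
  have "is_int_basis_matrix n (SOME B. is_int_basis_matrix n B \<Lambda>) \<Lambda>" using B by (rule someI)
  with B show ?thesis unfolding rat_space_def by (intro equalityI sub)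
qed

end

theory Submission
  imports Defs
begin

text \<open>
  Integer row reduction completes \<open>B\<close> to an invertible integer matrix \<open>[C; E]\<close> (\<open>C\<close> stacked
  on \<open>E\<close>) with \<open>B E\<^sup>T = 0\<close>; then the rows of \<open>E\<close> form a basis of the orthogonal lattice, and
  \<open>B = H F\<close> for \<open>H = B C\<^sup>T\<close> and some integer matrix \<open>F\<close>. By the Cauchy-Binet formula \<open>det H\<close>
  is an integer combination of the \<open>k \<times> k\<close> minors of \<open>B\<close>, and \<open>B = H F\<close> shows that it divides
  each of them, so \<open>\<Omega> = |det H|\<close>.

  Put \<open>A = B S\<^sup>-\<^sup>1\<close>, \<open>X = C S\<close>, \<open>Y = E S\<close> and \<open>Z = [A; Y]\<close>. Since \<open>A Y\<^sup>T = B E\<^sup>T = 0\<close>, the matrix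
  \<open>Z Z\<^sup>T\<close> is block diagonal with blocks \<open>A A\<^sup>T\<close> and \<open>Y Y\<^sup>T\<close>, whereas \<open>Z [X; Y]\<^sup>T\<close> is block
  triangular with diagonal blocks \<open>H\<close> and \<open>Y Y\<^sup>T\<close>. Comparing determinants yields
  \<open>(det H)\<^sup>2 det (Y Y\<^sup>T) = (det S)\<^sup>2 det (A A\<^sup>T)\<close>, and Cauchy-Binet expands \<open>det (A A\<^sup>T)\<close> into the
  squared minors of \<open>A\<close>.
\<close>

section \<open>Minors and the Cauchy-Binet formula\<close>

lemma bij_betw_permutes_compose:
  assumes bij: "bij_betw h K I"
  shows "bij_betw (\<lambda>p x. if x \<in> K then h (p x) else x) {p. p permutes K}
           {f. bij_betw f K I \<and> (\<forall>x. x \<notin> K \<longrightarrow> f x = x)}"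
proof (rule bij_betw_byWitness[where f' = "\<lambda>f x. if x \<in> K then inv_into K h (f x) else x"])
  let ?compose = "\<lambda>p x. if x \<in> K then h (p x) else x"
    and ?lift = "\<lambda>f x. if x \<in> K then inv_into K h (f x) else x"
  show "\<forall>p \<in> {p. p permutes K}. ?lift (?compose p) = p"
    using bij by (auto simp: fun_eq_iff bij_betw_inv_into_left permutes_in_image permutes_not_in)
  show "\<forall>f \<in> {f. bij_betw f K I \<and> (\<forall>x. x \<notin> K \<longrightarrow> f x = x)}. ?compose (?lift f) = f"
    using bij by (auto simp: fun_eq_iff bij_betw_inv_into_right bij_betwE)
  show "?compose ` {p. p permutes K} \<subseteq> {f. bij_betw f K I \<and> (\<forall>x. x \<notin> K \<longrightarrow> f x = x)}"
  proof clarsimp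
    fix p assume "p permutes K"
    then have "bij_betw (h \<circ> p) K I" using bij permutes_imp_bij bij_betw_trans by blast
    then show "bij_betw (?compose p) K I" by (rule bij_betw_cong[THEN iffD1, rotated]) simp
  qed
  show "?lift ` {f. bij_betw f K I \<and> (\<forall>x. x \<notin> K \<longrightarrow> f x = x)} \<subseteq> {p. p permutes K}"
  proof clarsimp
    fix f assume "bij_betw f K I"
    then have "bij_betw (inv_into K h \<circ> f) K K" using bij bij_betw_inv_into bij_betw_trans by blast
    then have "bij_betw (?lift f) K K" by (rule bij_betw_cong[THEN iffD1, rotated]) simp
    then show "?lift f permutes K" by (rule bij_imp_permutes) simp
  qed
qed

lemma bij_betw_pick:
  assumes "finite I"
  shows "bij_betw (pick I) {0..<card I} I"
proof (rule bij_betwI[where g = "\<lambda>i. card {a \<in> I. a < i}"])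
  show "pick I \<in> {0..<card I} \<rightarrow> I" by (auto intro: pick_in_set)
  show "(\<lambda>i. card {a \<in> I. a < i}) \<in> I \<rightarrow> {0..<card I}"
    using assms by (auto intro!: psubset_card_mono)
qed (auto simp: card_pick pick_card_in_set)

lemma pick_less:
  assumes "I \<subseteq> {..<n}" and "j < card I"
  shows "pick I j < n"
  using assms pick_in_set[of j I] by auto

lemma submatrix_transpose: "submatrix A\<^sup>T I J = (submatrix A J I)\<^sup>T"
  by (intro eq_matI) (auto simp: submatrix_def pick_le)

lemma map_mat_submatrix: "map_mat f (submatrix A I J) = submatrix (map_mat f A) I J"
  by (intro eq_matI) (auto simp: submatrix_def pick_le)

lemma submatrix_mult:
  assumes "A \<in> carrier_mat n r" and "B \<in> carrier_mat r m"
  shows "submatrix (A * B) I J = submatrix A I UNIV * submatrix B UNIV J"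
  using assms
  by (intro eq_matI) (auto simp: submatrix_def pick_le pick_UNIV scalar_prod_def)

lemma submatrix_UNIV_UNIV: "submatrix A UNIV UNIV = A"
  by (intro eq_matI) (auto simp: submatrix_def pick_UNIV)

lemma submatrix_UNIV_left:
  assumes "A \<in> carrier_mat k n" "I \<subseteq> {..<n}"
  shows "submatrix A UNIV I = mat k (card I) (\<lambda>(i, j). A $$ (i, pick I j))"
proof -
  have "{j. j < n \<and> j \<in> I} = I" using assms by auto
  then show ?thesis using assms by (simp add: submatrix_def pick_UNIV)
qed

lemma submatrix_UNIV_right:
  assumes "A \<in> carrier_mat n k" "I \<subseteq> {..<n}"
  shows "submatrix A I UNIV = mat (card I) k (\<lambda>(i, j). A $$ (pick I i, j))"
proof -
  have "{i. i < n \<and> i \<in> I} = I" using assms by auto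
  then show ?thesis using assms by (simp add: submatrix_def pick_UNIV)
qed

lemma det_mult_eq_sum_functions:
  fixes A B :: "'a :: comm_ring_1 mat"
  assumes A: "A \<in> carrier_mat k n" and B: "B \<in> carrier_mat n k"
  shows "det (A * B) = (\<Sum>f | (\<forall>i \<in> {0..<k}. f i \<in> {0..<n}) \<and> (\<forall>i. i \<notin> {0..<k} \<longrightarrow> f i = i).
           (\<Prod>i = 0..<k. A $$ (i, f i)) * det (mat\<^sub>r k k (\<lambda>i. row B (f i))))"
    (is "_ = sum ?g ?F")
proof -
  have "det (A * B) = (\<Sum>f \<in> ?F. det (mat\<^sub>r k k (\<lambda>i. A $$ (i, f i) \<cdot>\<^sub>v row B (f i))))"
    unfolding mat_mul_finsum_alt[OF A B] using B by (intro det_linear_rows_sum) auto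
  also have "\<dots> = sum ?g ?F"
    using B by (intro sum.cong refl det_rows_mul) auto
  finally show ?thesis .
qed

lemma sum_bijections_eq_det_mult_det:
  fixes A B :: "'a :: comm_ring_1 mat"
  assumes A: "A \<in> carrier_mat k n" and B: "B \<in> carrier_mat n k"
    and I: "I \<subseteq> {..<n}" "card I = k"
  shows "(\<Sum>f | bij_betw f {0..<k} I \<and> (\<forall>i. i \<notin> {0..<k} \<longrightarrow> f i = i).
      (\<Prod>i = 0..<k. A $$ (i, f i)) * det (mat\<^sub>r k k (\<lambda>i. row B (f i)))) =
    det (submatrix A UNIV I) * det (submatrix B I UNIV)"
    (is "sum ?g _ = _")
proof -
  let ?K = "{0..<k}"
  let ?f = "\<lambda>p i. if i \<in> ?K then pick I (p i) else i"
  have "finite I" using I(1) finite_subset by blast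
  then have pick: "bij_betw (pick I) ?K I" using bij_betw_pick I(2) by blast
  have AI: "submatrix A UNIV I = mat k k (\<lambda>(i, j). A $$ (i, pick I j))"
    and BI: "submatrix B I UNIV = mat k k (\<lambda>(i, j). B $$ (pick I i, j))"
    using submatrix_UNIV_left[OF A I(1)] submatrix_UNIV_right[OF B I(1)] I(2) by auto
  have summand: "?g (?f p) =
      signof p * (\<Prod>i = 0..<k. submatrix A UNIV I $$ (i, p i)) * det (submatrix B I UNIV)"
    if p: "p permutes ?K" for p
  proof -
    have less: "p i < k \<longleftrightarrow> i < k" for i using permutes_in_image[OF p, of i] by auto
    have "mat\<^sub>r k k (\<lambda>i. row B (?f p i)) = mat k k (\<lambda>(i, j). submatrix B I UNIV $$ (p i, j))"
      using B I(2) less pick_less[OF I(1)] by (intro eq_matI) (auto simp: BI)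
    then have "det (mat\<^sub>r k k (\<lambda>i. row B (?f p i))) = signof p * det (submatrix B I UNIV)"
      using det_permute_rows[OF _ p, of "submatrix B I UNIV"] by (simp add: BI)
    moreover have "(\<Prod>i = 0..<k. A $$ (i, ?f p i)) = (\<Prod>i = 0..<k. submatrix A UNIV I $$ (i, p i))"
      using less by (intro prod.cong) (auto simp: AI)
    ultimately show ?thesis by (simp only: mult_ac)
  qed
  have "sum ?g {f. bij_betw f ?K I \<and> (\<forall>i. i \<notin> ?K \<longrightarrow> f i = i)} = (\<Sum>p | p permutes ?K. ?g (?f p))"
    by (rule sum.reindex_bij_betw[OF bij_betw_permutes_compose[OF pick], symmetric])
  also have "\<dots> = (\<Sum>p | p permutes ?K. signof p * (\<Prod>i = 0..<k. submatrix A UNIV I $$ (i, p i))) *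
      det (submatrix B I UNIV)"
    using summand by (simp add: sum_distrib_right)
  also have "(\<Sum>p | p permutes ?K. signof p * (\<Prod>i = 0..<k. submatrix A UNIV I $$ (i, p i))) =
      det (submatrix A UNIV I)"
    by (rule det_def'[symmetric]) (simp add: AI)
  finally show ?thesis .
qed

theorem cauchy_binet:
  fixes A B :: "'a :: comm_ring_1 mat"
  assumes A: "A \<in> carrier_mat k n" and B: "B \<in> carrier_mat n k"
  shows "det (A * B) = (\<Sum>I | I \<subseteq> {..<n} \<and> card I = k.
           det (submatrix A UNIV I) * det (submatrix B I UNIV))"
proof -
  let ?K = "{0..<k}" and ?S = "{I. I \<subseteq> {..<n} \<and> card I = k}"
  let ?g = "\<lambda>f. (\<Prod>i = 0..<k. A $$ (i, f i)) * det (mat\<^sub>r k k (\<lambda>i. row B (f i)))"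
  let ?F = "{f. (\<forall>i \<in> ?K. f i \<in> {0..<n}) \<and> (\<forall>i. i \<notin> ?K \<longrightarrow> f i = i)}"
  have finite: "finite ?F" by (rule finite_bounded_functions) auto
  have noninjective: "?g f = 0" if "\<not> inj_on f ?K" for f
  proof -
    from that obtain i j where "i < k" "j < k" "i \<noteq> j" "f i = f j"
      by (auto simp: inj_on_def)
    then have "det (mat\<^sub>r k k (\<lambda>i. row B (f i))) = 0"
      using B by (intro det_identical_rows[of _ k i j]) auto
    then show ?thesis by simp
  qed
  have bijections: "{f \<in> {f \<in> ?F. inj_on f ?K}. f ` ?K = I} =
      {f. bij_betw f ?K I \<and> (\<forall>i. i \<notin> ?K \<longrightarrow> f i = i)}" if "I \<in> ?S" for I
    using that by (auto simp: bij_betw_def)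
  have "det (A * B) = sum ?g ?F"
    by (rule det_mult_eq_sum_functions[OF A B])
  also have "\<dots> = sum ?g {f \<in> ?F. inj_on f ?K}"
    using finite noninjective by (intro sum.mono_neutral_right) auto
  also have "\<dots> = (\<Sum>I \<in> ?S. \<Sum>f | f \<in> {f \<in> ?F. inj_on f ?K} \<and> f ` ?K = I. ?g f)"
  proof (rule sum.group[symmetric])
    show "finite {f \<in> ?F. inj_on f ?K}" using finite by (rule rev_finite_subset) blast
  qed (auto simp: card_image)
  also have "\<dots> = (\<Sum>I \<in> ?S. det (submatrix A UNIV I) * det (submatrix B I UNIV))"
  proof (rule sum.cong[OF refl])
    fix I assume I: "I \<in> ?S"
    then show "(\<Sum>f | f \<in> {f \<in> ?F. inj_on f ?K} \<and> f ` ?K = I. ?g f) =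
        det (submatrix A UNIV I) * det (submatrix B I UNIV)"
      unfolding bijections[OF I] by (intro sum_bijections_eq_det_mult_det[OF A B]) auto
  qed
  finally show ?thesis .
qed

corollary det_gram_eq_sum_minors_squared:
  fixes A :: "'a :: comm_ring_1 mat"
  assumes A: "A \<in> carrier_mat k n"
  shows "det (A * A\<^sup>T) = (\<Sum>I | I \<subseteq> {..<n} \<and> card I = k. (det (submatrix A UNIV I))\<^sup>2)"
proof -
  have "det (submatrix A\<^sup>T I UNIV) = det (submatrix A UNIV I)" if "I \<subseteq> {..<n}" "card I = k" for I
    unfolding submatrix_transpose
    by (rule det_transpose[of _ k]) (simp add: submatrix_UNIV_left[OF A] that)
  then show ?thesis
    using cauchy_binet[OF A, of "A\<^sup>T"] A by (simp add: power2_eq_square)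
qed

lemma det_submatrix_mult_left:
  fixes H A :: "'a :: comm_ring_1 mat"
  assumes H: "H \<in> carrier_mat k k" and A: "A \<in> carrier_mat k n"
    and I: "I \<subseteq> {..<n}" "card I = k"
  shows "det (submatrix (H * A) UNIV I) = det H * det (submatrix A UNIV I)"
  unfolding submatrix_mult[OF H A] submatrix_UNIV_UNIV
  by (rule det_mult[OF H]) (simp add: submatrix_UNIV_left[OF A] I)

lemma det_mat_diag: "det (mat_diag n d) = (\<Prod>i<n. d i :: 'a :: comm_ring_1)"
  by (subst det_upper_triangular[of _ n])
    (auto simp: mat_diag_def prod_list_diag_prod atLeast0LessThan)

lemma det_submatrix_mult_diag:
  fixes A :: "'a :: comm_ring_1 mat"
  assumes A: "A \<in> carrier_mat k n" and I: "I \<subseteq> {..<n}" "card I = k"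
  shows "det (submatrix (A * mat_diag n d) UNIV I) = det (submatrix A UNIV I) * (\<Prod>i\<in>I. d i)"
proof -
  let ?AI = "submatrix A UNIV I" and ?dI = "mat_diag k (\<lambda>j. d (pick I j))"
  have AI: "?AI \<in> carrier_mat k k" using submatrix_UNIV_left[OF A I(1)] I(2) by simp
  have pick: "bij_betw (pick I) {..<k} I"
    using bij_betw_pick[of I] I finite_subset by (auto simp: atLeast0LessThan)
  have "submatrix (A * mat_diag n d) UNIV I = ?AI * ?dI"
    unfolding mat_diag_mult_right[OF AI]
    using pick_less[OF I(1)] A I(2) submatrix_UNIV_left[OF _ I(1), of "A * mat_diag n d" k]
    by (intro eq_matI) (auto simp: mat_diag_mult_right[OF A] submatrix_UNIV_left[OF A I(1)])
  then have "det (submatrix (A * mat_diag n d) UNIV I) = det ?AI * (\<Prod>j<k. d (pick I j))"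
    by (simp add: det_mult[OF AI] det_mat_diag)
  then show ?thesis by (simp add: prod.reindex_bij_betw[OF pick])
qed

lemma det_gram_mult_diag_eq_sum_minors:
  fixes A :: "'a :: comm_ring_1 mat"
  assumes A: "A \<in> carrier_mat k n"
  shows "det ((A * mat_diag n d) * (A * mat_diag n d)\<^sup>T) =
    (\<Sum>I | I \<subseteq> {..<n} \<and> card I = k. (det (submatrix A UNIV I) * (\<Prod>i\<in>I. d i))\<^sup>2)"
proof -
  have "A * mat_diag n d \<in> carrier_mat k n" using A by (simp add: mat_diag_def)
  from det_gram_eq_sum_minors_squared[OF this] show ?thesis
    by (simp add: det_submatrix_mult_diag[OF A])
qed

lemma Gcd_minors_eq_det:
  fixes B :: "'a :: {idom, semiring_Gcd} mat"
  assumes B: "B \<in> carrier_mat k n" and C: "C \<in> carrier_mat n k" and F: "F \<in> carrier_mat k n"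
    and factorization: "B = (B * C) * F"
  shows "Gcd {det (submatrix B UNIV I) | I. I \<subseteq> {..<n} \<and> card I = k} = normalize (det (B * C))"
    (is "Gcd ?M = _")
proof -
  have BC: "B * C \<in> carrier_mat k k" using B C by simp
  have "Gcd ?M dvd (\<Sum>I | I \<subseteq> {..<n} \<and> card I = k.
      det (submatrix B UNIV I) * det (submatrix C I UNIV))"
    by (intro dvd_sum dvd_mult2 Gcd_dvd) auto
  then have "Gcd ?M dvd det (B * C)" by (simp only: cauchy_binet[OF B C])
  moreover have "det (B * C) dvd Gcd ?M"
  proof (rule Gcd_greatest)
    fix d assume "d \<in> ?M"
    then obtain I where "I \<subseteq> {..<n}" "card I = k" "d = det (submatrix ((B * C) * F) UNIV I)"
      using factorization by auto
    then show "det (B * C) dvd d" by (simp add: det_submatrix_mult_left[OF BC F])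
  qed
  ultimately show ?thesis using associatedI[of "Gcd ?M" "det (B * C)"] by simp
qed

section \<open>Invertible matrices and row reduction\<close>

lemma invertible_matE:
  assumes "A \<in> carrier_mat n n" and "invertible_mat A"
  obtains B where "B \<in> carrier_mat n n" "A * B = 1\<^sub>m n" "B * A = 1\<^sub>m n"
proof -
  obtain B where B: "A * B = 1\<^sub>m n" "B * A = 1\<^sub>m (dim_row B)"
    using assms by (auto simp: invertible_mat_def inverts_mat_def)
  have "dim_col B = n" "dim_row B = n"
    using arg_cong[OF B(1), of dim_col] arg_cong[OF B(2), of dim_col] assms(1) by auto
  then show thesis using that[of B] B by auto
qed

lemma invertible_mat_iff_det_dvd_1:
  fixes A :: "'a :: comm_ring_1 mat"
  assumes A: "A \<in> carrier_mat n n"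
  shows "invertible_mat A \<longleftrightarrow> det A dvd 1"
proof
  assume "invertible_mat A"
  with A obtain B where "B \<in> carrier_mat n n" "A * B = 1\<^sub>m n"
    by (rule invertible_matE)
  then have "1 = det A * det B" using det_mult[OF A] by (metis det_one)
  then show "det A dvd 1" by (rule dvdI)
next
  assume "det A dvd 1"
  then obtain u where "1 = det A * u" by (rule dvdE)
  then have u: "u * det A = 1" by (simp add: mult.commute)
  let ?B = "u \<cdot>\<^sub>m adj_mat A"
  note adjugate = adj_mat[OF A]
  have unit: "u \<cdot>\<^sub>m (det A \<cdot>\<^sub>m 1\<^sub>m n) = 1\<^sub>m n"
    by (intro eq_matI) (simp_all add: u flip: mult.assoc)
  have "A * ?B = 1\<^sub>m n" using mult_smult_distrib[OF A adjugate(1)] adjugate(2) unit by simp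
  moreover have "?B * A = 1\<^sub>m n"
    using mult_smult_assoc_mat[OF adjugate(1) A] adjugate(3) unit by simp
  ultimately show "invertible_mat A"
    using A adjugate(1) by (auto simp: invertible_mat_def inverts_mat_def)
qed

lemma invertible_mat_mult:
  fixes A B :: "'a :: comm_ring_1 mat"
  assumes "A \<in> carrier_mat n n" "invertible_mat A" and "B \<in> carrier_mat n n" "invertible_mat B"
  shows "invertible_mat (A * B)"
  using assms mult_dvd_mono[of "det A" 1 "det B" 1]
  by (simp add: invertible_mat_iff_det_dvd_1[of _ n] det_mult[of _ n])

lemma mult_transpose_cancel_inverse:
  fixes M N P Q :: "'a :: comm_ring_1 mat"
  assumes M: "M \<in> carrier_mat k n" and N: "N \<in> carrier_mat r n"
    and P: "P \<in> carrier_mat n n" and Q: "Q \<in> carrier_mat n n" and inverse: "P * Q = 1\<^sub>m n"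
  shows "(M * Q\<^sup>T) * (N * P)\<^sup>T = M * N\<^sup>T"
proof -
  have PT: "P\<^sup>T \<in> carrier_mat n n" and QT: "Q\<^sup>T \<in> carrier_mat n n" and NT: "N\<^sup>T \<in> carrier_mat n r"
    using N P Q by auto
  have "(M * Q\<^sup>T) * (N * P)\<^sup>T = M * (Q\<^sup>T * (P\<^sup>T * N\<^sup>T))"
    unfolding transpose_mult[OF N P] by (rule assoc_mult_mat[OF M QT mult_carrier_mat[OF PT NT]])
  also have "Q\<^sup>T * (P\<^sup>T * N\<^sup>T) = (P * Q)\<^sup>T * N\<^sup>T"
    unfolding transpose_mult[OF P Q] by (rule assoc_mult_mat[OF QT PT NT, symmetric])
  finally show ?thesis using NT by (simp add: inverse)
qed

lemma invertible_mat_one: "invertible_mat (1\<^sub>m n :: 'a :: comm_ring_1 mat)"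
  by (simp add: invertible_mat_iff_det_dvd_1[of _ n])

lemma invertible_mat_addrow:
  assumes "i \<noteq> j"
  shows "invertible_mat (addrow_mat n a i j :: 'a :: comm_ring_1 mat)"
  using det_addrow_mat[OF assms, of n a] by (simp add: invertible_mat_iff_det_dvd_1[of _ n])

lemma invertible_mat_swaprows:
  assumes "i < n" "j < n" "i \<noteq> j"
  shows "invertible_mat (swaprows_mat n i j :: 'a :: comm_ring_1 mat)"
  using det_swaprows_mat[OF assms, where 'a = 'a]
  by (simp add: invertible_mat_iff_det_dvd_1[of _ n])

lemma invertible_mat_four_block_lower_left_zero:
  fixes A D :: "'a :: idom mat"
  assumes A: "A \<in> carrier_mat n n" "invertible_mat A"
    and D: "D \<in> carrier_mat m m" "invertible_mat D"
    and B: "B \<in> carrier_mat n m"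
  shows "invertible_mat (four_block_mat A B (0\<^sub>m m n) D)"
  unfolding invertible_mat_iff_det_dvd_1[OF four_block_carrier_mat[OF A(1) D(1)]]
    det_four_block_mat_lower_left_zero[OF A(1) B refl D(1)]
  using A D mult_dvd_mono[of "det A" 1 "det D" 1] by (simp add: invertible_mat_iff_det_dvd_1)

lemma four_block_mat_cases_first_column_zero:
  assumes A: "A \<in> carrier_mat (1 + m) (1 + k)"
    and zero: "\<And>i. 0 < i \<Longrightarrow> i < 1 + m \<Longrightarrow> A $$ (i, 0) = 0"
  obtains a r A' where "a \<in> carrier_mat 1 1" "r \<in> carrier_mat 1 k" "A' \<in> carrier_mat m k"
    "A = four_block_mat a r (0\<^sub>m m 1) A'"
proof -
  obtain a r z A' where "split_block A 1 1 = (a, r, z, A')"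
    by (metis prod_cases4)
  note blocks = split_block[OF this carrier_matD[OF A]]
  have "z $$ (i, 0) = A $$ (1 + i, 0)" if "i < m" for i
    using that blocks by simp
  then have "z = 0\<^sub>m m 1"
    using zero blocks(3) by (intro eq_matI) auto
  with blocks(1,2,4,5) show thesis by (intro that) simp_all
qed

lemma nonzero_entries_cases:
  fixes v :: "nat \<Rightarrow> 'a :: euclidean_ring"
  obtains (cleared) "\<forall>i < n. 0 < i \<longrightarrow> v i = 0"
    | (reducible) i j where "i < n" "j < n" "i \<noteq> j" "v j \<noteq> 0"
        "euclidean_size (v j) \<le> euclidean_size (v i)"
    | (single) p where "0 < p" "p < n" "\<forall>i < n. i \<noteq> p \<longrightarrow> v i = 0"
proof (cases "\<exists>p < n. 0 < p \<and> v p \<noteq> 0")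
  case True
  then obtain p where p: "p < n" "0 < p" "v p \<noteq> 0" by blast
  show thesis
  proof (cases "\<exists>q < n. q \<noteq> p \<and> v q \<noteq> 0")
    case True
    then obtain q where "q < n" "q \<noteq> p" "v q \<noteq> 0" by blast
    then show thesis using reducible[of q p] reducible[of p q] p nat_le_linear by blast
  qed (use p single in blast)
qed (use cleared in blast)

lemma sum_euclidean_size_addrow_less:
  fixes A :: "'a :: euclidean_ring mat"
  assumes A: "A \<in> carrier_mat n k" and c: "c < k"
    and ij: "i < n" "j < n" "i \<noteq> j"
    and nonzero: "A $$ (j, c) \<noteq> 0"
    and size: "euclidean_size (A $$ (j, c)) \<le> euclidean_size (A $$ (i, c))"
  shows "(\<Sum>l<n. euclidean_size (addrow (- (A $$ (i, c) div A $$ (j, c))) i j A $$ (l, c))) <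
    (\<Sum>l<n. euclidean_size (A $$ (l, c)))"
    (is "(\<Sum>l<n. euclidean_size (?A' $$ (l, c))) < _")
proof (rule sum_strict_mono_ex1)
  have "?A' $$ (i, c) = A $$ (i, c) mod A $$ (j, c)"
    using A c ij by (simp add: minus_div_mult_eq_mod[symmetric])
  then have less: "euclidean_size (?A' $$ (i, c)) < euclidean_size (A $$ (i, c))"
    using mod_size_less[OF nonzero] size by (metis order_less_le_trans)
  then show "\<exists>l \<in> {..<n}. euclidean_size (?A' $$ (l, c)) < euclidean_size (A $$ (l, c))"
    using ij by blast
  have "?A' $$ (l, c) = A $$ (l, c)" if "l < n" "l \<noteq> i" for l
    using that A c by simp
  then show "\<forall>l \<in> {..<n}. euclidean_size (?A' $$ (l, c)) \<le> euclidean_size (A $$ (l, c))"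
    using less by (metis lessThan_iff order_less_imp_le order_refl)
qed simp

lemma ex_invertible_mult_column_zero_below:
  fixes A :: "'a :: euclidean_ring mat"
  assumes "A \<in> carrier_mat n k" and c: "c < k"
  shows "\<exists>U \<in> carrier_mat n n. invertible_mat U \<and> (\<forall>i < n. 0 < i \<longrightarrow> (U * A) $$ (i, c) = 0)"
  using assms(1)
proof (induction "\<Sum>i<n. euclidean_size (A $$ (i, c))" arbitrary: A rule: less_induct)
  case (less A)
  note A = less.prems
  show ?case
  proof (cases rule: nonzero_entries_cases[of n "\<lambda>i. A $$ (i, c)"])
    case cleared
    then show ?thesis
      using A by (intro bexI[of _ "1\<^sub>m n"]) (auto simp: invertible_mat_one)
  next
    case (reducible i j)
    let ?q = "- (A $$ (i, c) div A $$ (j, c))"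
    let ?R = "addrow_mat n ?q i j" and ?A' = "addrow ?q i j A"
    have A': "?A' \<in> carrier_mat n k" using A by simp
    obtain U where U: "U \<in> carrier_mat n n" "invertible_mat U"
      "\<forall>i < n. 0 < i \<longrightarrow> (U * ?A') $$ (i, c) = 0"
      using less.hyps[OF sum_euclidean_size_addrow_less[OF A c reducible] A'] by blast
    have "U * ?A' = (U * ?R) * A"
      using addrow_mat[OF A reducible(2)] assoc_mult_mat[OF U(1) _ A] by simp
    moreover have "invertible_mat (U * ?R)"
      using invertible_mat_mult[OF U(1,2) _ invertible_mat_addrow[OF reducible(3)]] by simp
    moreover have "U * ?R \<in> carrier_mat n n" using U(1) by simp
    ultimately show ?thesis using U(3) by metis
  next
    case (single p)
    let ?R = "swaprows_mat n 0 p :: 'a mat"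
    have "?R * A = swaprows 0 p A" using swaprows_mat[OF A, of 0 p] single by simp
    then have "\<forall>i < n. 0 < i \<longrightarrow> (?R * A) $$ (i, c) = 0" using single A c by simp
    moreover have "invertible_mat ?R" using single by (intro invertible_mat_swaprows) auto
    ultimately show ?thesis using swaprows_mat_carrier by metis
  qed
qed

lemma ex_invertible_mult_upper_triangular:
  fixes A :: "'a :: euclidean_ring mat"
  assumes "A \<in> carrier_mat n k"
  shows "\<exists>U \<in> carrier_mat n n. invertible_mat U \<and>
    (\<forall>i < n. \<forall>j < k. j < i \<longrightarrow> (U * A) $$ (i, j) = 0)"
  using assms
proof (induction k arbitrary: n A)
  case 0
  then show ?case by (intro bexI[of _ "1\<^sub>m n"]) (auto simp: invertible_mat_one)
next
  case (Suc k n A)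
  show ?case
  proof (cases n)
    case 0
    then show ?thesis by (intro bexI[of _ "1\<^sub>m n"]) (auto simp: invertible_mat_one)
  next
    case n: (Suc m)
    obtain V where V: "V \<in> carrier_mat n n" "invertible_mat V"
      "\<forall>i < n. 0 < i \<longrightarrow> (V * A) $$ (i, 0) = 0"
      using ex_invertible_mult_column_zero_below[OF Suc.prems, of 0] by blast
    have "V * A \<in> carrier_mat (1 + m) (1 + k)" using V(1) Suc.prems n by simp
    then obtain a r A' where blocks: "a \<in> carrier_mat 1 1" "r \<in> carrier_mat 1 k"
      "A' \<in> carrier_mat m k" "V * A = four_block_mat a r (0\<^sub>m m 1) A'"
      using V(3) n by (elim four_block_mat_cases_first_column_zero) auto
    obtain U where U: "U \<in> carrier_mat m m" "invertible_mat U"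
      "\<forall>i < m. \<forall>j < k. j < i \<longrightarrow> (U * A') $$ (i, j) = 0"
      using Suc.IH[OF blocks(3)] by blast
    let ?W = "four_block_mat (1\<^sub>m 1) (0\<^sub>m 1 m) (0\<^sub>m m 1) U"
    have W: "?W \<in> carrier_mat n n"
      using four_block_carrier_mat[OF one_carrier_mat[of 1] U(1)] n by simp
    have "invertible_mat ?W"
      using U(1,2) by (intro invertible_mat_four_block_lower_left_zero invertible_mat_one) auto
    then have "invertible_mat (?W * V)" using invertible_mat_mult[OF W _ V(1,2)] by blast
    moreover have "(?W * V) * A = four_block_mat a r (0\<^sub>m m 1) (U * A')"
      using mult_four_block_mat[of "1\<^sub>m 1" 1 1 "0\<^sub>m 1 m" m "0\<^sub>m m 1" m U a 1 r k "0\<^sub>m m 1" A']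
        blocks U(1) assoc_mult_mat[OF W V(1) Suc.prems] by simp
    moreover have "four_block_mat a r (0\<^sub>m m 1) (U * A') $$ (i, j) = 0"
      if "i < n" "j < Suc k" "j < i" for i j
      using that blocks U(1,3) n by (cases j) auto
    ultimately show ?thesis using W V(1) by (intro bexI[of _ "?W * V"]) auto
  qed
qed

section \<open>Stacked matrices\<close>

lemma dim_append_rows [simp]:
  "dim_row (A @\<^sub>r B) = dim_row A + dim_row B" "dim_col (A @\<^sub>r B) = dim_col A"
  by (simp_all add: append_rows_def)

lemma row_append_rows:
  assumes "dim_col A = dim_col B" "i < dim_row A + dim_row B"
  shows "row (A @\<^sub>r B) i = (if i < dim_row A then row A i else row B (i - dim_row A))"
  using assms by (intro eq_vecI) (auto simp: append_rows_def)

lemma col_append_rows: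
  assumes "dim_col A = dim_col B" "j < dim_col A"
  shows "col (A @\<^sub>r B) j = col A j @\<^sub>v col B j"
  using assms by (intro eq_vecI) (auto simp: append_rows_def)

lemma append_rows_mult:
  assumes "A \<in> carrier_mat k n" "B \<in> carrier_mat m n" "C \<in> carrier_mat n r"
  shows "(A @\<^sub>r B) * C = (A * C) @\<^sub>r (B * C)"
  using assms
  by (intro eq_rowI) (auto simp: row_append_rows)

lemma append_rows_mult_transpose:
  assumes "A \<in> carrier_mat k n" "B \<in> carrier_mat m n" "C \<in> carrier_mat p n" "D \<in> carrier_mat q n"
  shows "(A @\<^sub>r B) * (C @\<^sub>r D)\<^sup>T = four_block_mat (A * C\<^sup>T) (A * D\<^sup>T) (B * C\<^sup>T) (B * D\<^sup>T)"
  using assms by (intro eq_matI) (auto simp: row_append_rows)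

lemma transpose_append_rows_mult:
  assumes "A \<in> carrier_mat k n" "B \<in> carrier_mat m n" "C \<in> carrier_mat k r" "D \<in> carrier_mat m r"
  shows "(A @\<^sub>r B)\<^sup>T * (C @\<^sub>r D) = A\<^sup>T * C + B\<^sup>T * D"
  using assms by (intro eq_matI) (auto simp: col_append_rows scalar_prod_append[of _ k _ m])

lemma map_mat_append_rows:
  assumes "A \<in> carrier_mat k n" "B \<in> carrier_mat m n"
  shows "map_mat f (A @\<^sub>r B) = map_mat f A @\<^sub>r map_mat f B"
  using assms by (intro eq_matI) (auto simp: append_rows_def)

lemma append_rows_cases:
  assumes A: "A \<in> carrier_mat (k + m) n"
  obtains C D where "C \<in> carrier_mat k n" "D \<in> carrier_mat m n" "A = C @\<^sub>r D"
proof (rule that)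
  show "A = mat k n (($$) A) @\<^sub>r mat m n (\<lambda>(i, j). A $$ (k + i, j))"
    using A by (intro eq_matI) (auto simp: append_rows_def)
qed simp_all

lemma invertible_append_rows_decomposition:
  fixes C E :: "'a :: comm_ring_1 mat"
  assumes C: "C \<in> carrier_mat k n" and E: "E \<in> carrier_mat m n"
    and invertible: "invertible_mat (C @\<^sub>r E)"
  obtains F G where "F \<in> carrier_mat k n" "G \<in> carrier_mat m n"
    "C\<^sup>T * F + E\<^sup>T * G = 1\<^sub>m n" "G * E\<^sup>T = 1\<^sub>m m"
proof -
  let ?U = "C @\<^sub>r E"
  have U: "?U \<in> carrier_mat (k + m) n" using C E by simp
  then have n: "k + m = n" using invertible C E by (simp add: invertible_mat_def)
  obtain W where W: "W \<in> carrier_mat n n" "?U * W = 1\<^sub>m n" "W * ?U = 1\<^sub>m n"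
    using invertible_matE[OF U[unfolded n] invertible] .
  obtain F G where F: "F \<in> carrier_mat k n" and G: "G \<in> carrier_mat m n" and FG: "W\<^sup>T = F @\<^sub>r G"
    using append_rows_cases[of "W\<^sup>T" k m n] W(1) n by auto
  have "C\<^sup>T * F + E\<^sup>T * G = ?U\<^sup>T * W\<^sup>T"
    unfolding FG by (rule transpose_append_rows_mult[OF C E F G, symmetric])
  also have "\<dots> = 1\<^sub>m n" using transpose_mult[OF W(1) U[unfolded n]] W(3) by simp
  finally have decomposition: "C\<^sup>T * F + E\<^sup>T * G = 1\<^sub>m n" .
  have "four_block_mat (F * C\<^sup>T) (F * E\<^sup>T) (G * C\<^sup>T) (G * E\<^sup>T) = W\<^sup>T * ?U\<^sup>T"
    unfolding FG by (rule append_rows_mult_transpose[OF F G C E, symmetric])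
  also have "\<dots> = 1\<^sub>m n" using transpose_mult[OF U[unfolded n] W(1)] W(2) by simp
  finally have blocks: "four_block_mat (F * C\<^sup>T) (F * E\<^sup>T) (G * C\<^sup>T) (G * E\<^sup>T) = 1\<^sub>m (k + m)"
    unfolding n .
  have "G * E\<^sup>T = 1\<^sub>m m"
  proof (rule eq_matI)
    fix i j assume "i < dim_row (1\<^sub>m m :: 'a mat)" "j < dim_col (1\<^sub>m m :: 'a mat)"
    then show "(G * E\<^sup>T) $$ (i, j) = 1\<^sub>m m $$ (i, j)"
      using arg_cong[OF blocks, of "\<lambda>M. M $$ (k + i, k + j)"] C E F G by simp
  qed (use E G in auto)
  with F G decomposition show thesis by (rule that)
qed

lemma det_gram_of_orthogonal:
  fixes A C E :: "'a :: idom mat"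
  assumes A: "A \<in> carrier_mat k (k + m)" and C: "C \<in> carrier_mat k (k + m)"
    and E: "E \<in> carrier_mat m (k + m)"
    and orthogonal: "A * E\<^sup>T = 0\<^sub>m k m" and nonzero: "det (E * E\<^sup>T) \<noteq> 0"
  shows "(det (A * C\<^sup>T))\<^sup>2 * det (E * E\<^sup>T) = det (A * A\<^sup>T) * (det (C @\<^sub>r E))\<^sup>2"
proof -
  let ?Z = "A @\<^sub>r E" and ?X = "C @\<^sub>r E"
  have Z: "?Z \<in> carrier_mat (k + m) (k + m)" and X: "?X \<in> carrier_mat (k + m) (k + m)"
    using A C E by auto
  have "det ?Z * det ?X = det (?Z * ?X\<^sup>T)"
    using X by (simp add: det_mult[OF Z] det_transpose[OF X])
  also have "\<dots> = det (A * C\<^sup>T) * det (E * E\<^sup>T)"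
    unfolding append_rows_mult_transpose[OF A E C E] orthogonal
    using A C E by (intro det_four_block_mat_upper_right_zero) auto
  finally have ZX: "det ?Z * det ?X = det (A * C\<^sup>T) * det (E * E\<^sup>T)" .
  have "(det ?Z)\<^sup>2 = det (?Z * ?Z\<^sup>T)"
    using Z by (simp add: det_mult[OF Z] det_transpose[OF Z] power2_eq_square)
  also have "\<dots> = det (A * A\<^sup>T) * det (E * E\<^sup>T)"
    unfolding append_rows_mult_transpose[OF A E A E] orthogonal
    using A E by (intro det_four_block_mat_upper_right_zero) auto
  finally have ZZ: "(det ?Z)\<^sup>2 = det (A * A\<^sup>T) * det (E * E\<^sup>T)" .
  have "((det (A * C\<^sup>T))\<^sup>2 * det (E * E\<^sup>T)) * det (E * E\<^sup>T) = (det ?Z * det ?X)\<^sup>2"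
    by (simp add: ZX power2_eq_square)
  also have "\<dots> = (det (A * A\<^sup>T) * (det ?X)\<^sup>2) * det (E * E\<^sup>T)"
    by (simp add: power_mult_distrib ZZ)
  finally show ?thesis using nonzero by simp
qed

section \<open>Orthogonal completions\<close>

definition orthogonal_completion ::
    "nat \<Rightarrow> nat \<Rightarrow> 'a :: comm_ring_1 mat \<Rightarrow> 'a mat \<Rightarrow> 'a mat \<Rightarrow> bool" where
  "orthogonal_completion k m B C E \<longleftrightarrow>
     B \<in> carrier_mat k (k + m) \<and> C \<in> carrier_mat k (k + m) \<and> E \<in> carrier_mat m (k + m) \<and>
     invertible_mat (C @\<^sub>r E) \<and> B * E\<^sup>T = 0\<^sub>m k m"

lemma orthogonal_completionD:
  assumes "orthogonal_completion k m B C E"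
  shows "B \<in> carrier_mat k (k + m)" "C \<in> carrier_mat k (k + m)" "E \<in> carrier_mat m (k + m)"
    "invertible_mat (C @\<^sub>r E)" "B * E\<^sup>T = 0\<^sub>m k m"
  using assms by (auto simp: orthogonal_completion_def)

lemma ex_orthogonal_completion:
  fixes B :: "'a :: euclidean_ring mat"
  assumes B: "B \<in> carrier_mat k (k + m)"
  obtains C E where "orthogonal_completion k m B C E"
proof -
  have BT: "B\<^sup>T \<in> carrier_mat (k + m) k" using B by simp
  obtain U where U: "U \<in> carrier_mat (k + m) (k + m)" "invertible_mat U"
    "\<forall>i < k + m. \<forall>j < k. j < i \<longrightarrow> (U * B\<^sup>T) $$ (i, j) = 0"
    using ex_invertible_mult_upper_triangular[OF BT] by blast
  obtain C E where C: "C \<in> carrier_mat k (k + m)" and E: "E \<in> carrier_mat m (k + m)"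
    and CE: "U = C @\<^sub>r E"
    using append_rows_cases[OF U(1)] .
  have UB: "U * B\<^sup>T = (C * B\<^sup>T) @\<^sub>r (E * B\<^sup>T)"
    unfolding CE by (rule append_rows_mult[OF C E BT])
  have "E * B\<^sup>T = 0\<^sub>m m k"
  proof (rule eq_matI)
    fix i j assume "i < dim_row (0\<^sub>m m k :: 'a mat)" "j < dim_col (0\<^sub>m m k :: 'a mat)"
    then have ij: "i < m" "j < k" by simp_all
    then have "(E * B\<^sup>T) $$ (i, j) = (U * B\<^sup>T) $$ (k + i, j)"
      unfolding UB using B C E by (simp add: append_rows_def)
    then show "(E * B\<^sup>T) $$ (i, j) = 0\<^sub>m m k $$ (i, j)" using U(3) ij by simp
  qed (use B E in auto)
  then have "B * E\<^sup>T = 0\<^sub>m k m" using transpose_mult[OF E BT] by simp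
  then show thesis using that B C E U(2) CE by (auto simp: orthogonal_completion_def)
qed

lemma orthogonal_completion_factorization:
  assumes completion: "orthogonal_completion k m B C E"
  obtains F where "F \<in> carrier_mat k (k + m)" "B = (B * C\<^sup>T) * F"
proof -
  note B = orthogonal_completionD(1)[OF completion] and C = orthogonal_completionD(2)[OF completion]
    and E = orthogonal_completionD(3)[OF completion]
  obtain F G where F: "F \<in> carrier_mat k (k + m)" and G: "G \<in> carrier_mat m (k + m)"
    and decomposition: "C\<^sup>T * F + E\<^sup>T * G = 1\<^sub>m (k + m)"
    using invertible_append_rows_decomposition[OF C E orthogonal_completionD(4)[OF completion]] .
  have CT: "C\<^sup>T \<in> carrier_mat (k + m) k" and ET: "E\<^sup>T \<in> carrier_mat (k + m) m" using C E by auto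
  have "B = B * (C\<^sup>T * F + E\<^sup>T * G)" unfolding decomposition using B by simp
  also have "\<dots> = B * (C\<^sup>T * F) + B * (E\<^sup>T * G)"
    using B CT ET F G by (intro mult_add_distrib_mat) auto
  also have "\<dots> = (B * C\<^sup>T) * F + (B * E\<^sup>T) * G"
    by (simp only: assoc_mult_mat[OF B CT F] assoc_mult_mat[OF B ET G])
  also have "\<dots> = (B * C\<^sup>T) * F"
    unfolding orthogonal_completionD(5)[OF completion] using B CT F G by simp
  finally show thesis using that F by blast
qed

lemma orthogonal_completion_transpose_kernel:
  assumes completion: "orthogonal_completion k m B C E"
    and v: "v \<in> carrier_vec m" and zero: "E\<^sup>T *\<^sub>v v = 0\<^sub>v (k + m)"
  shows "v = 0\<^sub>v m"
proof -
  note E = orthogonal_completionD(3)[OF completion]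
  obtain F G where G: "G \<in> carrier_mat m (k + m)" and left_inverse: "G * E\<^sup>T = 1\<^sub>m m"
    using invertible_append_rows_decomposition[OF orthogonal_completionD(2-4)[OF completion]]
    by metis
  have "v = G *\<^sub>v (E\<^sup>T *\<^sub>v v)"
    using assoc_mult_mat_vec[OF G _ v, of "E\<^sup>T"] E v left_inverse by simp
  then show ?thesis using zero G by auto
qed

lemma orthogonal_completion_of_int:
  assumes completion: "orthogonal_completion k m B C E"
  shows "orthogonal_completion k m (map_mat of_int B :: 'a :: comm_ring_1 mat)
    (map_mat of_int C) (map_mat of_int E)"
proof -
  let ?h = "map_mat (of_int :: int \<Rightarrow> 'a)"
  note B = orthogonal_completionD(1)[OF completion] and C = orthogonal_completionD(2)[OF completion]
    and E = orthogonal_completionD(3)[OF completion]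
  have "?h B * (?h E)\<^sup>T = ?h (B * E\<^sup>T)"
    using B E by (simp add: of_int_hom.mat_hom_mult[of B k "k + m" _ m] map_mat_transpose)
  also have "\<dots> = 0\<^sub>m k m" unfolding orthogonal_completionD(5)[OF completion] by auto
  finally have "?h B * (?h E)\<^sup>T = 0\<^sub>m k m" .
  moreover have "det (C @\<^sub>r E) dvd 1"
    using orthogonal_completionD(4)[OF completion] C E
    by (simp add: invertible_mat_iff_det_dvd_1[of _ "k + m"])
  then have "invertible_mat (?h C @\<^sub>r ?h E)"
    using C E of_int_hom.hom_dvd[of "det (C @\<^sub>r E)" 1, where 'a = 'a]
    by (simp add: invertible_mat_iff_det_dvd_1[of _ "k + m"] flip: map_mat_append_rows)
  ultimately show ?thesis using B C E by (simp add: orthogonal_completion_def)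
qed

lemma det_gram_orthogonal_completion_transform:
  fixes B C E :: "'a :: idom mat"
  assumes completion: "orthogonal_completion k m B C E" and n: "n = k + m"
    and T: "T \<in> carrier_mat n n" and T': "T' \<in> carrier_mat n n" and inverse: "T * T' = 1\<^sub>m n"
    and nonzero: "det ((E * T) * (E * T)\<^sup>T) \<noteq> 0"
  defines "A \<equiv> B * T'\<^sup>T"
  shows "(det (B * C\<^sup>T))\<^sup>2 * det ((E * T) * (E * T)\<^sup>T) =
    det (A * A\<^sup>T) * (det (C @\<^sub>r E) * det T)\<^sup>2"
proof -
  note B = orthogonal_completionD(1)[OF completion, folded n]
    and C = orthogonal_completionD(2)[OF completion, folded n]
    and E = orthogonal_completionD(3)[OF completion, folded n]
  have A: "A \<in> carrier_mat k n" and CT: "C * T \<in> carrier_mat k n" and ET: "E * T \<in> carrier_mat m n"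
    using B C E T T' by (auto simp: A_def)
  have "A * (E * T)\<^sup>T = 0\<^sub>m k m"
    unfolding A_def mult_transpose_cancel_inverse[OF B E T T' inverse]
    by (rule orthogonal_completionD(5)[OF completion])
  then have "(det (A * (C * T)\<^sup>T))\<^sup>2 * det ((E * T) * (E * T)\<^sup>T) =
      det (A * A\<^sup>T) * (det ((C * T) @\<^sub>r (E * T)))\<^sup>2"
    using A CT ET nonzero unfolding n by (intro det_gram_of_orthogonal)
  moreover have "A * (C * T)\<^sup>T = B * C\<^sup>T"
    unfolding A_def by (rule mult_transpose_cancel_inverse[OF B C T T' inverse])
  moreover have "det ((C * T) @\<^sub>r (E * T)) = det (C @\<^sub>r E) * det T"
    unfolding append_rows_mult[OF C E T, symmetric]
    using det_mult[OF _ T] carrier_append_rows[OF C E] n by simp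
  ultimately show ?thesis by simp
qed

lemma kernel_eq_orthogonal_completion_range:
  fixes B C E :: "'a :: idom mat"
  assumes completion: "orthogonal_completion k m B C E" and nonzero: "det (B * C\<^sup>T) \<noteq> 0"
  shows "{x \<in> carrier_vec (k + m). B *\<^sub>v x = 0\<^sub>v k} = {E\<^sup>T *\<^sub>v y | y. y \<in> carrier_vec m}"
proof -
  note B = orthogonal_completionD(1)[OF completion] and C = orthogonal_completionD(2)[OF completion]
    and E = orthogonal_completionD(3)[OF completion]
  have CT: "C\<^sup>T \<in> carrier_mat (k + m) k" and ET: "E\<^sup>T \<in> carrier_mat (k + m) m"
    and BC: "B * C\<^sup>T \<in> carrier_mat k k" using B C E by auto
  obtain F G where F: "F \<in> carrier_mat k (k + m)" and G: "G \<in> carrier_mat m (k + m)"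
    and decomposition: "C\<^sup>T * F + E\<^sup>T * G = 1\<^sub>m (k + m)"
    using invertible_append_rows_decomposition[OF C E orthogonal_completionD(4)[OF completion]] .
  have range_in_kernel: "B *\<^sub>v (E\<^sup>T *\<^sub>v y) = 0\<^sub>v k" if "y \<in> carrier_vec m" for y
    unfolding assoc_mult_mat_vec[OF B ET that, symmetric] orthogonal_completionD(5)[OF completion]
    using that by auto
  have "x = E\<^sup>T *\<^sub>v (G *\<^sub>v x)" if x: "x \<in> carrier_vec (k + m)" and Bx: "B *\<^sub>v x = 0\<^sub>v k" for x
  proof -
    have Fx: "F *\<^sub>v x \<in> carrier_vec k" and Gx: "G *\<^sub>v x \<in> carrier_vec m" using F G x by auto
    have "x = (C\<^sup>T * F + E\<^sup>T * G) *\<^sub>v x" unfolding decomposition using x by simp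
    also have "\<dots> = (C\<^sup>T * F) *\<^sub>v x + (E\<^sup>T * G) *\<^sub>v x"
      using CT ET F G x by (intro add_mult_distrib_mat_vec) auto
    also have "\<dots> = C\<^sup>T *\<^sub>v (F *\<^sub>v x) + E\<^sup>T *\<^sub>v (G *\<^sub>v x)"
      by (simp only: assoc_mult_mat_vec[OF CT F x] assoc_mult_mat_vec[OF ET G x])
    finally have x_decomposition: "x = C\<^sup>T *\<^sub>v (F *\<^sub>v x) + E\<^sup>T *\<^sub>v (G *\<^sub>v x)" .
    then have "0\<^sub>v k = B *\<^sub>v (C\<^sup>T *\<^sub>v (F *\<^sub>v x) + E\<^sup>T *\<^sub>v (G *\<^sub>v x))" using Bx by metis
    also have "\<dots> = B *\<^sub>v (C\<^sup>T *\<^sub>v (F *\<^sub>v x)) + B *\<^sub>v (E\<^sup>T *\<^sub>v (G *\<^sub>v x))"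
      using CT ET Fx Gx by (intro mult_add_distrib_mat_vec[OF B]) auto
    also have "\<dots> = (B * C\<^sup>T) *\<^sub>v (F *\<^sub>v x)"
      using range_in_kernel[OF Gx] assoc_mult_mat_vec[OF B CT Fx] mult_mat_vec_carrier[OF BC Fx]
      by simp
    finally have "F *\<^sub>v x = 0\<^sub>v k"
      using det_0_iff_vec_prod_zero[OF BC] nonzero Fx by metis
    moreover have "C\<^sup>T *\<^sub>v 0\<^sub>v k = 0\<^sub>v (k + m)" using CT by auto
    ultimately show ?thesis using x_decomposition mult_mat_vec_carrier[OF ET Gx] by simp
  qed
  then show ?thesis using range_in_kernel mult_mat_vec_carrier[OF ET] mult_mat_vec_carrier[OF G]
    by blast
qed

lemma Gcd_minors_eq_det_orthogonal_completion:
  fixes B C E :: "'a :: {idom, semiring_Gcd} mat"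
  assumes completion: "orthogonal_completion k m B C E"
  shows "Gcd {det (submatrix B UNIV I) | I. I \<subseteq> {..<k + m} \<and> card I = k} =
    normalize (det (B * C\<^sup>T))"
proof -
  obtain F where "F \<in> carrier_mat k (k + m)" "B = (B * C\<^sup>T) * F"
    using orthogonal_completion_factorization[OF completion] .
  then show ?thesis
    using orthogonal_completionD(1,2)[OF completion] by (intro Gcd_minors_eq_det) auto
qed

section \<open>Basis matrices of lattices\<close>

lemma is_basis_matrixI:
  assumes C: "C \<in> carrier_mat m n"
    and trivial_kernel: "\<And>v. v \<in> carrier_vec m \<Longrightarrow> C\<^sup>T *\<^sub>v v = 0\<^sub>v n \<Longrightarrow> v = 0\<^sub>v m"
  shows "is_basis_matrix n C {C\<^sup>T *\<^sub>v map_vec real_of_int x | x. x \<in> carrier_vec m}"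
proof -
  have unit: "C\<^sup>T *\<^sub>v unit_vec m i = row C i" if "i < m" for i
    using C that by (intro eq_vecI) auto
  have distinct: "distinct (rows C)"
  proof (rule ccontr)
    assume "\<not> distinct (rows C)"
    then obtain i j where ij: "i < m" "j < m" "i \<noteq> j" "row C i = row C j"
      using C by (auto simp: distinct_conv_nth)
    have "C\<^sup>T *\<^sub>v (unit_vec m i - unit_vec m j) = C\<^sup>T *\<^sub>v unit_vec m i - C\<^sup>T *\<^sub>v unit_vec m j"
      using C by (intro mult_minus_distrib_mat_vec) auto
    also have "\<dots> = 0\<^sub>v n" using C ij by (simp add: unit)
    finally have "unit_vec m i - unit_vec m j = (0\<^sub>v m :: real vec)" by (intro trivial_kernel) auto
    then have "(unit_vec m i - unit_vec m j :: real vec) $ i = 0" using ij by simp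
    then show False using ij by simp
  qed
  have "module.lin_indpt class_ring (module_vec TYPE(real) n) (set (rows C))"
  proof
    assume "module.lin_dep class_ring (module_vec TYPE(real) n) (set (rows C))"
    then obtain v where "v \<in> carrier_vec m" "v \<noteq> 0\<^sub>v m" "C\<^sup>T *\<^sub>v v = 0\<^sub>v n"
      using vec_space.lin_depE[of "C\<^sup>T" n m] C distinct by auto
    then show False using trivial_kernel by blast
  qed
  then show ?thesis using C distinct by (simp add: is_basis_matrix_def)
qed

lemma is_basis_matrix_dim_row_le:
  assumes "is_basis_matrix n C \<Gamma>"
  shows "dim_row C \<le> n"
proof -
  interpret vec_space "TYPE(real)" n .
  have C: "dim_col C = n" "distinct (rows C)" "lin_indpt (set (rows C))"
    using assms by (auto simp: is_basis_matrix_def)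
  have "set (rows C) \<subseteq> carrier_vec n" using rows_carrier[of C] C(1) by simp
  then have "card (set (rows C)) \<le> dim" using li_le_dim(2)[OF fin_dim] C(3) by simp
  then show ?thesis using C(2) by (simp add: distinct_card dim_is_n)
qed

lemma is_basis_matrix_transform:
  assumes basis: "is_basis_matrix n C \<Gamma>"
    and T: "T \<in> carrier_mat n n" and invertible: "invertible_mat T"
  shows "is_basis_matrix n (C * T) (lattice_transform \<Gamma> T)"
proof -
  define m where "m = dim_row C"
  have C: "C \<in> carrier_mat m n" and \<Gamma>: "\<Gamma> = {C\<^sup>T *\<^sub>v map_vec real_of_int x | x. x \<in> carrier_vec m}"
    using basis by (auto simp: is_basis_matrix_def m_def)
  have CT: "C\<^sup>T \<in> carrier_mat n m" and TT: "T\<^sup>T \<in> carrier_mat n n" using C T by auto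
  have mult: "(C * T)\<^sup>T *\<^sub>v v = T\<^sup>T *\<^sub>v (C\<^sup>T *\<^sub>v v)" if "v \<in> carrier_vec m" for v
    unfolding transpose_mult[OF C T] by (rule assoc_mult_mat_vec[OF TT CT that])
  have "det T\<^sup>T \<noteq> 0"
    using invertible det_transpose[OF T] by (auto simp: invertible_mat_iff_det_dvd_1[OF T])
  then have "v = 0\<^sub>v m" if "v \<in> carrier_vec m" "(C * T)\<^sup>T *\<^sub>v v = 0\<^sub>v n" for v
    using that mult[OF that(1)] mult_mat_vec_carrier[OF CT that(1)] det_0_iff_vec_prod_zero[OF TT]
      is_basis_matrix_kernel[OF basis] by (metis m_def)
  then have "is_basis_matrix n (C * T) {(C * T)\<^sup>T *\<^sub>v map_vec real_of_int x | x. x \<in> carrier_vec m}"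
    using C T by (intro is_basis_matrixI) auto
  also have "{(C * T)\<^sup>T *\<^sub>v map_vec real_of_int x | x. x \<in> carrier_vec m} = lattice_transform \<Gamma> T"
    unfolding lattice_transform_def \<Gamma> Setcompr_eq_image image_image
    using mult by (intro image_cong) auto
  finally show ?thesis .
qed

lemma det_gram_basis_matrix_nonzero:
  assumes basis: "is_basis_matrix n C \<Gamma>"
  shows "det (C * C\<^sup>T) \<noteq> 0"
proof
  define m where "m = dim_row C"
  have C: "C \<in> carrier_mat m n" using basis by (auto simp: is_basis_matrix_def m_def)
  then have CT: "C\<^sup>T \<in> carrier_mat n m" and CC: "C * C\<^sup>T \<in> carrier_mat m m" by auto
  assume "det (C * C\<^sup>T) = 0"
  then obtain v where v: "v \<in> carrier_vec m" "v \<noteq> 0\<^sub>v m" "(C * C\<^sup>T) *\<^sub>v v = 0\<^sub>v m"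
    using det_0_iff_vec_prod_zero[OF CC] by blast
  have Cv: "C\<^sup>T *\<^sub>v v \<in> carrier_vec n" using CT v(1) by (rule mult_mat_vec_carrier)
  have "(C\<^sup>T *\<^sub>v v) \<bullet> (C\<^sup>T *\<^sub>v v) = v \<bullet> (C *\<^sub>v (C\<^sup>T *\<^sub>v v))"
    by (rule transpose_vec_mult_scalar[OF C Cv v(1)])
  also have "C *\<^sub>v (C\<^sup>T *\<^sub>v v) = 0\<^sub>v m"
    using assoc_mult_mat_vec[OF C CT v(1)] v(3) by metis
  also have "v \<bullet> 0\<^sub>v m = 0" using v(1) by simp
  finally have "C\<^sup>T *\<^sub>v v = 0\<^sub>v n"
    using conjugate_square_eq_0_vec[OF Cv] by simp
  then show False using is_basis_matrix_kernel[OF basis] v(1,2) m_def by simp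
qed

lemma is_int_basis_matrix_kernel:
  assumes basis: "is_int_basis_matrix n B \<Lambda>"
    and x: "x \<in> carrier_vec (dim_row B)" and zero: "B\<^sup>T *\<^sub>v x = 0\<^sub>v n"
  shows "x = 0\<^sub>v (dim_row B)"
proof -
  have "B\<^sup>T \<in> carrier_mat n (dim_row B)"
    using basis by (auto simp: is_int_basis_matrix_def is_basis_matrix_def)
  then have "(map_mat real_of_int B)\<^sup>T *\<^sub>v map_vec real_of_int x = map_vec real_of_int (B\<^sup>T *\<^sub>v x)"
    using of_int_hom.mult_mat_vec_hom[OF _ x, of "B\<^sup>T" n, where 'a = real]
    by (simp only: map_mat_transpose)
  also have "\<dots> = 0\<^sub>v n" unfolding zero by auto
  finally show ?thesis
    using is_basis_matrix_kernel[OF basis[unfolded is_int_basis_matrix_def],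
        of "map_vec real_of_int x"] x by simp
qed

lemma is_int_basis_matrix_factor_det_nonzero:
  assumes H: "H \<in> carrier_mat k k" and F: "F \<in> carrier_mat k n"
    and basis: "is_int_basis_matrix n (H * F) \<Lambda>"
  shows "det H \<noteq> 0"
proof
  have HT: "H\<^sup>T \<in> carrier_mat k k" and FT: "F\<^sup>T \<in> carrier_mat n k" using H F by auto
  assume "det H = 0"
  then obtain v where v: "v \<in> carrier_vec k" "v \<noteq> 0\<^sub>v k" "H\<^sup>T *\<^sub>v v = 0\<^sub>v k"
    using det_0_iff_vec_prod_zero[OF HT] det_transpose[OF H] by auto
  have "(H * F)\<^sup>T *\<^sub>v v = F\<^sup>T *\<^sub>v (H\<^sup>T *\<^sub>v v)"
    unfolding transpose_mult[OF H F] by (rule assoc_mult_mat_vec[OF FT HT v(1)])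
  also have "\<dots> = 0\<^sub>v n" using FT v(3) by auto
  finally show False using is_int_basis_matrix_kernel[OF basis] v(1,2) H by simp
qed

lemma is_int_basis_matrix_completion_det_nonzero:
  assumes completion: "orthogonal_completion k m B C E" and basis: "is_int_basis_matrix (k + m) B \<Lambda>"
  shows "det (B * C\<^sup>T) \<noteq> 0"
proof -
  obtain F where F: "F \<in> carrier_mat k (k + m)" "B = (B * C\<^sup>T) * F"
    using orthogonal_completion_factorization[OF completion] .
  have "B * C\<^sup>T \<in> carrier_mat k k" using orthogonal_completionD(1,2)[OF completion] by simp
  then show ?thesis
    using is_int_basis_matrix_factor_det_nonzero[OF _ F(1)] basis F(2) by metis
qed

section \<open>The orthogonal lattice\<close>

lemma orth_lattice_eq_kernel:
  assumes B: "B \<in> carrier_mat k n" and basis: "is_int_basis_matrix n B \<Lambda>"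
  shows "orth_lattice n \<Lambda> = {x \<in> carrier_vec n. B *\<^sub>v x = 0\<^sub>v k}"
proof -
  let ?Q = "map_mat rat_of_int B"
  have Q: "?Q \<in> carrier_mat k n" using B by simp
  have rows: "set (rows ?Q) = {row ?Q i | i. i < k}"
    using B by (auto simp: rows_def)
  have "vec_module.orthogonal_complement n (rat_space n \<Lambda>) =
      vec_module.orthogonal_complement n (set (rows ?Q))"
    unfolding rat_space_eq[OF basis] vec_space.row_space_def
    using Q rows_carrier[of ?Q] by (intro vec_space.in_orthogonal_complement_span) auto
  moreover have "map_vec rat_of_int x \<in> vec_module.orthogonal_complement n (set (rows ?Q)) \<longleftrightarrow>
      B *\<^sub>v x = 0\<^sub>v k" if x: "x \<in> carrier_vec n" for x
  proof -
    have "map_vec rat_of_int x \<bullet> row ?Q i = rat_of_int ((B *\<^sub>v x) $ i)" if "i < k" for i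
      using that B x by (simp add: scalar_prod_def mult.commute)
    then have "map_vec rat_of_int x \<in> vec_module.orthogonal_complement n (set (rows ?Q)) \<longleftrightarrow>
        (\<forall>i < k. (B *\<^sub>v x) $ i = 0)"
      unfolding vec_module.orthogonal_complement_def rows
      using x by (auto simp del: index_mult_mat_vec)
    also have "\<dots> \<longleftrightarrow> B *\<^sub>v x = 0\<^sub>v k"
      using B by (auto simp: vec_eq_iff)
    finally show ?thesis .
  qed
  ultimately show ?thesis unfolding orth_lattice_def by auto
qed

lemma is_int_basis_matrix_orth_lattice:
  assumes completion: "orthogonal_completion k m B C E"
    and basis: "is_int_basis_matrix (k + m) B \<Lambda>"
  shows "is_int_basis_matrix (k + m) E (orth_lattice (k + m) \<Lambda>)"
proof -
  let ?R = "map_mat real_of_int" and ?r = "map_vec real_of_int"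
  note E = orthogonal_completionD(3)[OF completion]
  have ET: "E\<^sup>T \<in> carrier_mat (k + m) m" using E by simp
  have "is_basis_matrix (k + m) (?R E) {(?R E)\<^sup>T *\<^sub>v ?r y | y. y \<in> carrier_vec m}"
    using E orthogonal_completion_transpose_kernel[OF orthogonal_completion_of_int[OF completion]]
    by (intro is_basis_matrixI) auto
  also have "{(?R E)\<^sup>T *\<^sub>v ?r y | y. y \<in> carrier_vec m} = ?r ` {E\<^sup>T *\<^sub>v y | y. y \<in> carrier_vec m}"
    unfolding Setcompr_eq_image image_image
    using of_int_hom.mult_mat_vec_hom[OF ET, where 'a = real]
    by (intro image_cong) (auto simp: map_mat_transpose)
  also have "{E\<^sup>T *\<^sub>v y | y. y \<in> carrier_vec m} = orth_lattice (k + m) \<Lambda>"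
    using kernel_eq_orthogonal_completion_range[OF completion]
      is_int_basis_matrix_completion_det_nonzero[OF completion basis]
      orth_lattice_eq_kernel[OF orthogonal_completionD(1)[OF completion] basis] by simp
  finally show ?thesis unfolding is_int_basis_matrix_def .
qed

lemma lattice_det_transform_orth_lattice:
  assumes completion: "orthogonal_completion k m B C E" and n: "n = k + m"
    and basis: "is_int_basis_matrix n B \<Lambda>"
    and T: "T \<in> carrier_mat n n" and T': "T' \<in> carrier_mat n n" and inverse: "T * T' = 1\<^sub>m n"
  defines "A \<equiv> map_mat real_of_int B * T'\<^sup>T"
  shows "lattice_det n (lattice_transform (map_vec real_of_int ` orth_lattice n \<Lambda>) T) =
    \<bar>det T\<bar> / real_of_int \<bar>det (B * C\<^sup>T)\<bar> * sqrt (det (A * A\<^sup>T))"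
proof -
  let ?R = "map_mat real_of_int"
  let ?Y = "?R E * T"
  note B = orthogonal_completionD(1)[OF completion] and C = orthogonal_completionD(2)[OF completion]
    and E = orthogonal_completionD(3)[OF completion]
  have "det T * det T' = 1" using det_mult[OF T T'] inverse by simp
  then have "invertible_mat T" unfolding invertible_mat_iff_det_dvd_1[OF T] by (metis dvd_triv_left)
  then have Y: "is_basis_matrix n ?Y
      (lattice_transform (map_vec real_of_int ` orth_lattice n \<Lambda>) T)"
    using is_int_basis_matrix_orth_lattice[OF completion basis[unfolded n], folded n] T
    by (intro is_basis_matrix_transform) (simp add: is_int_basis_matrix_def)
  have "?R B * (?R C)\<^sup>T = ?R (B * C\<^sup>T)"
    using B C by (simp add: of_int_hom.mat_hom_mult[of B k "k + m" _ k] map_mat_transpose)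
  then have "(real_of_int (det (B * C\<^sup>T)))\<^sup>2 * det (?Y * ?Y\<^sup>T) =
      det (A * A\<^sup>T) * (det (?R C @\<^sub>r ?R E) * det T)\<^sup>2"
    using det_gram_orthogonal_completion_transform[OF orthogonal_completion_of_int[OF completion]
        n T T' inverse det_gram_basis_matrix_nonzero[OF Y]]
    by (simp add: A_def)
  moreover have "\<bar>det (C @\<^sub>r E)\<bar> = 1"
    using orthogonal_completionD(4)[OF completion] C E
    by (simp add: invertible_mat_iff_det_dvd_1[of _ "k + m"])
  then have "(det (?R C @\<^sub>r ?R E))\<^sup>2 = 1"
    by (simp add: power2_eq_1_iff abs_if split: if_splits flip: map_mat_append_rows[OF C E])
  ultimately have "det (?Y * ?Y\<^sup>T) = (det T / real_of_int (det (B * C\<^sup>T)))\<^sup>2 * det (A * A\<^sup>T)"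
    using is_int_basis_matrix_completion_det_nonzero[OF completion basis[unfolded n]]
    by (simp add: field_simps)
  then show ?thesis unfolding lattice_det_eq[OF Y] by (simp add: real_sqrt_mult)
qed

theorem theorem3p3:
  fixes n k :: nat and \<Lambda> :: "int vec set" and B :: "int mat" and S :: "nat \<Rightarrow> real"
  assumes "B \<in> carrier_mat k n"
    and "is_int_basis_matrix n B \<Lambda>"
    and "\<And>i. i < n \<Longrightarrow> S i \<noteq> 0"
  shows "lattice_det n
           (lattice_transform (map_vec real_of_int ` orth_lattice n \<Lambda>) (mat_diag n S)) =
         \<bar>\<Prod>i<n. S i\<bar> /
           real_of_int (Gcd {det (submatrix B UNIV I) | I. I \<subseteq> {..<n} \<and> card I = k}) *
         sqrt (\<Sum>I | I \<subseteq> {..<n} \<and> card I = k.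
                 (real_of_int (det (submatrix B UNIV I)) / (\<Prod>i\<in>I. S i))\<^sup>2)"
proof -
  have "k \<le> n"
    using is_basis_matrix_dim_row_le[OF assms(2)[unfolded is_int_basis_matrix_def]] assms(1) by simp
  then obtain m where n: "n = k + m" using le_Suc_ex by blast
  obtain C E where completion: "orthogonal_completion k m B C E"
    using ex_orthogonal_completion assms(1) unfolding n by blast
  let ?S' = "mat_diag n (\<lambda>i. 1 / S i)"
  have "mat_diag n S * ?S' = 1\<^sub>m n"
    using assms(3) unfolding mat_diag_diag by (intro eq_matI) (auto simp: mat_diag_def)
  moreover have "?S'\<^sup>T = ?S'" by (intro eq_matI) (auto simp: mat_diag_def)
  ultimately have "lattice_det n
        (lattice_transform (map_vec real_of_int ` orth_lattice n \<Lambda>) (mat_diag n S)) =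
      \<bar>\<Prod>i<n. S i\<bar> / real_of_int \<bar>det (B * C\<^sup>T)\<bar> *
      sqrt (\<Sum>I | I \<subseteq> {..<n} \<and> card I = k.
              (real_of_int (det (submatrix B UNIV I)) / (\<Prod>i\<in>I. S i))\<^sup>2)"
    using lattice_det_transform_orth_lattice[OF completion n assms(2), of "mat_diag n S" ?S']
    by (simp add: det_mat_diag det_gram_mult_diag_eq_sum_minors[of _ k] assms(1) prod_dividef
        flip: map_mat_submatrix)
  then show ?thesis
    using Gcd_minors_eq_det_orthogonal_completion[OF completion, folded n] by simp
qed

end
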